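(* Let $X$ be a closed and convex subset, not a singleton, of a normed space $(\widetilde{X},|\cdot|)$, and let $P,A\subseteq X$ be nonempty. Suppose that for all $x\in X$ the distance between $x$ and $P$ is attained. Then $\operatorname{dom}(P,A)$ is a union of line segments starting at the points of $P$. More precisely, given $p\in P$ and a unit vector $\theta\in\widetilde X$, let $$T(\theta,p)=\sup\{t\in [0,\infty): p+t\theta\in X \text{ and } d(p+t\theta,p)\leq d(p+t\theta,A)\}.$$ Then $$\operatorname{dom}(P,A)=\bigcup_{p\in P}\ \bigcup_{|\theta|=1}[p,p+T(\theta,p)\theta].$$ When $T(\theta,p)=\infty$, the notation $[p,p+T(\theta,p)\theta]$ means the ray $\{p+t\theta: t\in [0,\infty)\}$.
   Context: $d(x,y)=|x-y|$ and $d(x,A)=\inf\{d(x,a):a\in A\}$. "The distance between $x$ and $P$ is attained" means that there is $p\in P$ with $d(x,p)=d(x,P)$. $[p,x]=\{p+t(x-p):t\in[0,1]\}$. For nonempty $P,A\subseteq X$, $\operatorname{dom}(P,A)=\{x\in X: d(x,P)\leq d(x,A)\}$. *)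

theory Defs
  imports "HOL-Analysis.Analysis" "HOL-Library.Extended_Real"
begin

(* The ambient normed space is the type 'a; the world X is a subset of it. For nonempty S,
   infdist x S is the infimum of dist x s over s in S (the library sets it to 0 for S = {}),
   and dist x y = norm (x - y) on a normed space. *)

definition dominance_region ::
    "'a::real_normed_vector set \<Rightarrow> 'a set \<Rightarrow> 'a set \<Rightarrow> 'a set" where
  "dominance_region X P A = {x \<in> X. infdist x P \<le> infdist x A}"

(* The supremum is taken in the extended reals, so it is \<infinity> when the set of admissible t is
   unbounded. For p in X the set contains 0, hence the value is then never -\<infinity>. *)
definition ray_extent ::
    "'a::real_normed_vector set \<Rightarrow> 'a set \<Rightarrow> 'a \<Rightarrow> 'a \<Rightarrow> ereal" where
  "ray_extent X A \<theta> p =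
     Sup (ereal ` {t. 0 \<le> t \<and> p + t *\<^sub>R \<theta> \<in> X
                     \<and> dist (p + t *\<^sub>R \<theta>) p \<le> infdist (p + t *\<^sub>R \<theta>) A})"

(* [p, p + T \<theta>], read as the full ray when T = \<infinity>. *)
definition segment_or_ray ::
    "'a::real_normed_vector \<Rightarrow> ereal \<Rightarrow> 'a \<Rightarrow> 'a set" where
  "segment_or_ray p T \<theta> =
     (if T = \<infinity> then {p + t *\<^sub>R \<theta> | t. 0 \<le> t}
      else closed_segment p (p + real_of_ereal T *\<^sub>R \<theta>))"

end

theory Submission
  imports Defs
begin

text \<open>Since the distance to \<open>P\<close> is attained, the dominance region of \<open>P\<close> is the union over
  \<open>p \<in> P\<close> of the regions of the single points \<open>p\<close>. Moving from \<open>x\<close> towards \<open>p\<close> decreases the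
  distance to \<open>p\<close> by exactly the length of the move, and the distance to \<open>A\<close> by at most that
  length, so each of these regions is star-shaped at \<open>p\<close>; being closed, it contains the end point
  of each of its bounded rays.\<close>

lemma dist_le_infdist_closed_segment:
  fixes p x y :: "'a::real_normed_vector"
  assumes "dist x p \<le> infdist x A" and "y \<in> closed_segment p x"
  shows "dist y p \<le> infdist y A"
proof -
  obtain u where u: "0 \<le> u" "u \<le> 1" and y: "y = p + u *\<^sub>R (x - p)"
    using assms(2) by (auto simp: closed_segment_def algebra_simps)
  have "dist y p = u * dist x p"
    using u by (simp add: y dist_norm)
  moreover have "x - y = (1 - u) *\<^sub>R (x - p)"
    by (simp add: y algebra_simps)
  then have "dist x y = (1 - u) * dist x p"
    using u by (simp add: dist_norm)
  ultimately have "dist x p = dist y p + dist x y"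
    by (simp add: algebra_simps)
  \<comment> \<open>\<open>infdist\<close> to \<open>A\<close> is 1-Lipschitz, so passing from
    \<open>x\<close> to \<open>y\<close> costs at most \<open>dist x y\<close>, exactly what the
    distance to \<open>p\<close> loses.\<close>
  then show ?thesis
    using assms(1) infdist_triangle[of x A y] by linarith
qed

text \<open>A downward closed set of nonnegative reals is an interval starting at 0. If it is
  unbounded it is the whole half-line; otherwise closedness puts its supremum inside, so the end
  point of the segment is not lost.\<close>

lemma segment_or_ray_Sup:
  fixes p \<theta> :: "'a::real_normed_vector" and E :: "real set"
  assumes closed: "closed E" and zero: "0 \<in> E" and nonneg: "\<And>t. t \<in> E \<Longrightarrow> 0 \<le> t"
    and down: "\<And>s t. t \<in> E \<Longrightarrow> 0 \<le> s \<Longrightarrow> s \<le> t \<Longrightarrow> s \<in> E"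
  shows "segment_or_ray p (Sup (ereal ` E)) \<theta> = (\<lambda>t. p + t *\<^sub>R \<theta>) ` E"
proof (cases "Sup (ereal ` E) = \<infinity>")
  case True
  have "t \<in> E" if "0 \<le> t" for t
  proof -
    have "ereal t < Sup (ereal ` E)"
      by (simp add: True)
    then obtain s where "s \<in> E" "t < s"
      by (auto simp: less_Sup_iff)
    then show ?thesis
      using down that by auto
  qed
  then have "E = {t. 0 \<le> t}"
    using nonneg by auto
  then show ?thesis
    unfolding segment_or_ray_def if_P[OF True] by blast
next
  case False
  \<comment> \<open>This excludes the value \<open>-\<infinity>\<close>; together with
    \<open>False\<close> the supremum is a real number.\<close>
  have "ereal 0 \<le> Sup (ereal ` E)"
    using zero by (intro Sup_upper) auto
  with False obtain T where T: "Sup (ereal ` E) = ereal T" "0 \<le> T"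
    by (cases "Sup (ereal ` E)") auto
  have le: "t \<le> T" if "t \<in> E" for t
    using that Sup_upper[of "ereal t" "ereal ` E"] T by simp
  have "T = Sup E"
    using ereal_Sup[of E] T by simp
  moreover have "bdd_above E"
    using le by (rule bdd_aboveI)
  then have "Sup E \<in> E"
    using closed zero by (intro closed_contains_Sup) auto
  ultimately have "T \<in> E"
    by simp
  then have E: "E = {0..T}"
    using down[of T] le nonneg by (meson atLeastAtMost_iff subsetI subset_antisym)
  have "closed_segment p (p + T *\<^sub>R \<theta>) = (\<lambda>t. p + t *\<^sub>R \<theta>) ` closed_segment 0 T"
    using closed_segment_linear_image[of "\<lambda>t. t *\<^sub>R \<theta>" 0 T]
      closed_segment_translation[of p 0 "T *\<^sub>R \<theta>"]
    by (simp add: linear_scale_left image_image)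
  then show ?thesis
    using T(2) unfolding segment_or_ray_def T(1)
    by (simp add: E closed_segment_eq_real_ivl)
qed

text \<open>The admissible parameters form a closed set because \<open>X\<close> is closed and both
  distances are continuous, and a downward closed one because \<open>X\<close> is convex and the
  distance condition survives moving towards \<open>p\<close>.\<close>

lemma segment_or_ray_ray_extent:
  fixes p \<theta> :: "'a::real_normed_vector"
  assumes "closed X" and "convex X" and "p \<in> X" and "norm \<theta> = 1"
  shows "segment_or_ray p (ray_extent X A \<theta> p) \<theta> =
    {p + t *\<^sub>R \<theta> | t. 0 \<le> t \<and> p + t *\<^sub>R \<theta> \<in> X
       \<and> dist (p + t *\<^sub>R \<theta>) p \<le> infdist (p + t *\<^sub>R \<theta>) A}"
proof -
  define E where "E = {t. 0 \<le> t \<and> p + t *\<^sub>R \<theta> \<in> X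
                     \<and> dist (p + t *\<^sub>R \<theta>) p \<le> infdist (p + t *\<^sub>R \<theta>) A}"
  have "closed ((\<lambda>t. p + t *\<^sub>R \<theta>) -` X)"
    by (intro closed_vimage assms continuous_intros)
  then have "closed {t. p + t *\<^sub>R \<theta> \<in> X}"
    by (simp add: vimage_def)
  then have "closed E"
    unfolding E_def by (intro closed_Collect_conj closed_Collect_le continuous_intros)
  moreover have "0 \<in> E"
    using assms by (simp add: E_def infdist_nonneg)
  moreover have "0 \<le> t" if "t \<in> E" for t
    using that by (simp add: E_def)
  moreover have "s \<in> E" if "t \<in> E" "0 \<le> s" "s \<le> t" for s t
  proof -
    have "p + s *\<^sub>R \<theta> \<in> closed_segment p (p + t *\<^sub>R \<theta>)"
    \<comment> \<open>The point at parameter \<open>s\<close> divides the segment in the ratio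
      \<open>s / t\<close>; for \<open>t = 0\<close> also \<open>s = 0\<close>, and the segment is
      the point \<open>p\<close>.\<close>
    proof (cases "t = 0")
      case False
      then show ?thesis
        using that by (auto simp: in_segment algebra_simps intro!: exI[of _ "s / t"])
    qed (use that in auto)
    moreover have "closed_segment p (p + t *\<^sub>R \<theta>) \<subseteq> X"
      using assms that by (intro closed_segment_subset) (auto simp: E_def)
    ultimately show ?thesis
      using that dist_le_infdist_closed_segment by (auto simp: E_def)
  qed
  ultimately have "segment_or_ray p (Sup (ereal ` E)) \<theta> = (\<lambda>t. p + t *\<^sub>R \<theta>) ` E"
    by (rule segment_or_ray_Sup)
  then show ?thesis
    by (auto simp: ray_extent_def E_def)
qed

text \<open>A nearest point of \<open>P\<close> to \<open>x\<close> serves as the witness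
  \<open>p\<close>; conversely \<open>infdist x P\<close> is at most the distance to any
  \<open>p\<close> in \<open>P\<close>.\<close>

lemma dominance_region_eq_UN:
  assumes "\<forall>x\<in>X. \<exists>p\<in>P. dist x p = infdist x P"
  shows "dominance_region X P A = (\<Union>p\<in>P. {x \<in> X. dist x p \<le> infdist x A})"
proof -
  have "infdist x P \<le> infdist x A \<longleftrightarrow> (\<exists>p\<in>P. dist x p \<le> infdist x A)" if "x \<in> X" for x
    using assms that by (metis infdist_le order_trans)
  then show ?thesis
    by (auto simp: dominance_region_def)
qed

text \<open>Polar coordinates around \<open>p\<close>. At \<open>x = p\<close> any direction will
  do, but a unit vector must exist, hence the assumption of a nonzero vector.\<close>

lemma ex_unit_vector_polar:
  fixes p x :: "'a::real_normed_vector"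
  assumes "\<exists>v::'a. v \<noteq> 0"
  shows "\<exists>\<theta>. norm \<theta> = 1 \<and> x = p + dist x p *\<^sub>R \<theta>"
proof (cases "x = p")
  case True
  from assms obtain v :: 'a where "v \<noteq> 0" ..
  then show ?thesis
    by (intro exI[of _ "sgn v"]) (simp add: True norm_sgn)
next
  case False
  then have "norm (sgn (x - p)) = 1" "x = p + dist x p *\<^sub>R sgn (x - p)"
    by (simp_all add: norm_sgn dist_norm sgn_div_norm)
  then show ?thesis
    by blast
qed

theorem theorem5p4:
  fixes X P A :: "'a::real_normed_vector set"
  assumes "closed X" and "convex X" and "\<nexists>x. X = {x}"
    and "P \<subseteq> X" and "P \<noteq> {}" and "A \<subseteq> X" and "A \<noteq> {}"
    and "\<forall>x\<in>X. \<exists>p\<in>P. dist x p = infdist x P"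
  shows "(\<exists>S. fst ` S = P \<and> dominance_region X P A = (\<Union>(p, x)\<in>S. closed_segment p x))
    \<and> dominance_region X P A =
        (\<Union>p\<in>P. \<Union>\<theta>\<in>{\<theta>. norm \<theta> = 1}. segment_or_ray p (ray_extent X A \<theta> p) \<theta>)"
proof
  define D where "D = (\<lambda>p. {x \<in> X. dist x p \<le> infdist x A})"
  have dom: "dominance_region X P A = (\<Union>p\<in>P. D p)"
    unfolding D_def using assms by (intro dominance_region_eq_UN)
  have centre: "p \<in> D p" if "p \<in> P" for p
    using that assms by (auto simp: D_def infdist_nonneg)
  have segment: "closed_segment p x \<subseteq> D p" if "p \<in> P" "x \<in> D p" for p x
    using that assms closed_segment_subset[of p X x] dist_le_infdist_closed_segment
    by (fastforce simp: D_def)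
  \<comment> \<open>The witness \<open>Sigma P D\<close> joins each \<open>p\<close> to every point
    of its region. No \<open>p\<close> is missed, since the degenerate pair \<open>(p, p)\<close>
    belongs to it.\<close>
  have "fst ` Sigma P D = P"
    using centre by force
  moreover have "(\<Union>p\<in>P. D p) = (\<Union>(p, x)\<in>Sigma P D. closed_segment p x)"
    using segment by fastforce
  ultimately show "\<exists>S. fst ` S = P \<and> dominance_region X P A = (\<Union>(p, x)\<in>S. closed_segment p x)"
    using dom by (intro exI[of _ "Sigma P D"]) simp
  \<comment> \<open>Two distinct points of \<open>X\<close> differ by a nonzero vector. Without one
    there would be no unit vectors, and the union over \<open>\<theta>\<close> would be
    empty.\<close>
  obtain q where "q \<in> X"
    using assms by blast
  with assms(3) obtain r where "r \<in> X" "r \<noteq> q"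
    by blast
  then have nontrivial: "\<exists>v::'a. v \<noteq> 0"
    by (intro exI[of _ "r - q"]) simp
  have "D p = (\<Union>\<theta>\<in>{\<theta>. norm \<theta> = 1}. segment_or_ray p (ray_extent X A \<theta> p) \<theta>)" if "p \<in> P" for p
  proof -
    have "p \<in> X"
      using that assms by blast
    \<comment> \<open>Each segment or ray is thus the part of \<open>D p\<close> on a half-line from
      \<open>p\<close>; it remains to see that these half-lines cover the space.\<close>
    have ray: "segment_or_ray p (ray_extent X A \<theta> p) \<theta> =
        {p + t *\<^sub>R \<theta> | t. 0 \<le> t \<and> p + t *\<^sub>R \<theta> \<in> D p}" if "norm \<theta> = 1" for \<theta>
      using segment_or_ray_ray_extent[OF assms(1,2) \<open>p \<in> X\<close> that, of A] by (simp add: D_def)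
    have polar: "\<exists>\<theta>. norm \<theta> = 1 \<and> (\<exists>t\<ge>0. x = p + t *\<^sub>R \<theta>)" for x
      using ex_unit_vector_polar[OF nontrivial, of x p] zero_le_dist by blast
    show ?thesis
    proof
      show "D p \<subseteq> (\<Union>\<theta>\<in>{\<theta>. norm \<theta> = 1}. segment_or_ray p (ray_extent X A \<theta> p) \<theta>)"
      proof
        fix x assume "x \<in> D p"
        moreover obtain \<theta> t where "norm \<theta> = 1" "0 \<le> t" "x = p + t *\<^sub>R \<theta>"
          using polar by blast
        ultimately show "x \<in> (\<Union>\<theta>\<in>{\<theta>. norm \<theta> = 1}. segment_or_ray p (ray_extent X A \<theta> p) \<theta>)"
          by (intro UN_I[of \<theta>]) (auto simp: ray)
      qed
    qed (auto simp: ray)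
  qed
  then show "dominance_region X P A =
      (\<Union>p\<in>P. \<Union>\<theta>\<in>{\<theta>. norm \<theta> = 1}. segment_or_ray p (ray_extent X A \<theta> p) \<theta>)"
    by (simp add: dom)
qed

end
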